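(* Let $n\ge1$ and let $\pi,\tilde\pi,\pi^\star$ be set partitions of $[n]=\{1,\dots,n\}$. Then $\pi\vee\tilde\pi=\pi^\star$ if and only if $V_\pi\cap V_{\tilde\pi}=V_{\pi^\star}$.
   Context: Partitions of $[n]$ are ordered by refinement ($\pi\le\tilde\pi$ if every block of $\pi$ is contained in a block of $\tilde\pi$), and $\pi\vee\tilde\pi$ denotes the least upper bound. For a set partition $\pi=B_1|\cdots|B_m$ of $[n]$, the $\vec{\boldsymbol 1}_n$-partition $\Lambda_\pi=(\boldsymbol\lambda_1,\dots,\boldsymbol\lambda_m)$ is the $n\times m$ matrix with $(\boldsymbol\lambda_j)_t=1$ if $t\in B_j$ and $0$ otherwise, and $V_\pi=\mathrm{span}(\boldsymbol\lambda_1,\dots,\boldsymbol\lambda_m)\subseteq\mathbb R^n$ is its column span. *)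

theory Defs
  imports "HOL-Analysis.Analysis"
begin

text \<open>
  The ground set [n] is represented by a finite type 'n with n = CARD('n) elements (so that n is
  automatically positive), and a set partition of [n] by an unordered collection of blocks
  satisfying \<open>partition_on UNIV\<close>.  The refinement order is \<open>refines\<close> from Disjoint_Sets.
\<close>

definition is_partition_lub :: "'a set \<Rightarrow> 'a set set \<Rightarrow> 'a set set \<Rightarrow> 'a set set \<Rightarrow> bool" where
  "is_partition_lub A P Q R \<longleftrightarrow>
     refines A P R \<and> refines A Q R \<and>
     (\<forall>S. refines A P S \<and> refines A Q S \<longrightarrow> refines A R S)"

definition partition_join :: "'a set \<Rightarrow> 'a set set \<Rightarrow> 'a set set \<Rightarrow> 'a set set" where
  "partition_join A P Q = (THE R. is_partition_lub A P Q R)"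

lemma is_partition_lub_unique:
  "is_partition_lub A P Q R \<Longrightarrow> is_partition_lub A P Q R' \<Longrightarrow> R = R'"
  unfolding is_partition_lub_def by (meson refines_asym)

lemma is_partition_lub_exists:
  assumes P: "partition_on A P" and Q: "partition_on A Q"
  shows "\<exists>R. is_partition_lub A P Q R"
proof -
  define U where "U = {S. refines A P S \<and> refines A Q S}"
  have part: "partition_on A S" if "S \<in> U" for S
    using that by (auto simp: U_def refines_def)
  have "{A} - {{}} \<in> U"
  proof (cases "A = {}")
    case True
    then show ?thesis
      using P Q by (auto simp: U_def refines_def partition_on_empty)
  next
    case False
    then show ?thesis
      using P Q partition_on_space[OF False]
      by (auto simp: U_def refines_def partition_on_def)
  qed
  then have ne: "U \<noteq> {}" by blast
  have "refines A P (common_refinement U)" "refines A Q (common_refinement U)"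
    by (rule common_refinement_coarsest; use part P Q ne in \<open>auto simp: U_def\<close>)+
  moreover have "refines A (common_refinement U) S" if "S \<in> U" for S
    using refines_common_refinement part that by blast
  ultimately show ?thesis
    unfolding is_partition_lub_def U_def by blast
qed

lemma is_partition_lub_join:
  assumes "partition_on A P" "partition_on A Q"
  shows "is_partition_lub A P Q (partition_join A P Q)"
  unfolding partition_join_def
  using is_partition_lub_exists[OF assms] is_partition_lub_unique by (metis theI)

definition block_vec :: "'n set \<Rightarrow> real ^ 'n" where
  "block_vec B = (\<chi> t. if t \<in> B then 1 else 0)"

text \<open>
  The vectors \<open>block_vec B\<close>, for B a block of \<open>P\<close>, are the columns of the matrix
  \<open>\<Lambda>\<^sub>P\<close>; its column span does not depend on how the blocks are numbered.
\<close>

definition partition_space :: "'n set set \<Rightarrow> (real ^ 'n) set" where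
  "partition_space P = span (block_vec ` P)"

end

theory Submission
  imports Defs
begin

text \<open>
  The space \<open>V\<^sub>P\<close> consists of the vectors that are constant on the blocks of \<open>P\<close>, so
  \<open>P \<mapsto> V\<^sub>P\<close> is an order-reversing embedding: \<open>V\<^sub>S \<subseteq> V\<^sub>P\<close> iff \<open>P\<close> refines \<open>S\<close>.  A vector
  \<open>x\<close> in \<open>V\<^sub>P \<inter> V\<^sub>Q\<close> has level sets that are unions of blocks of both \<open>P\<close> and \<open>Q\<close>, hence the
  join refines the partition into level sets of \<open>x\<close> and \<open>x\<close> lies in the space of the join.
\<close>

lemma partition_on_block_unique:
  assumes "partition_on A P" "B \<in> P" "C \<in> P" "t \<in> B" "t \<in> C"
  shows "B = C"
  using assms partition_onD2 by (meson disjointD disjoint_iff)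

text \<open>Vectors constant on the blocks form a subspace containing every
  \<open>block_vec B\<close>, hence the span. Conversely, such a vector is the combination of the
  block vectors weighted by its values on the blocks.\<close>

lemma mem_partition_space_iff:
  fixes P :: "'n::finite set set"
  assumes "partition_on UNIV P"
  shows "x \<in> partition_space P \<longleftrightarrow> (\<forall>B\<in>P. \<forall>s\<in>B. \<forall>t\<in>B. x $ s = x $ t)"
proof
  define W where "W = {x :: real^'n. \<forall>B\<in>P. \<forall>s\<in>B. \<forall>t\<in>B. x $ s = x $ t}"
  have "subspace W"
  proof (rule subspaceI)
    show "x + y \<in> W" if "x \<in> W" "y \<in> W" for x y
      unfolding W_def mem_Collect_eq vector_add_component
      using that unfolding W_def mem_Collect_eq by (intro ballI arg_cong2[of _ _ _ _ "(+)"]) blast+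
    show "c *\<^sub>R x \<in> W" if "x \<in> W" for c x
      unfolding W_def mem_Collect_eq vector_scaleR_component
      using that unfolding W_def mem_Collect_eq by (intro ballI arg_cong[of _ _ "(*\<^sub>R) c"]) blast
  qed (simp add: W_def)
  moreover have "block_vec ` P \<subseteq> W"
    using partition_on_block_unique[OF assms] unfolding W_def block_vec_def by fastforce
  ultimately have "partition_space P \<subseteq> W"
    unfolding partition_space_def by (rule span_minimal[rotated])
  then show "x \<in> partition_space P \<Longrightarrow> \<forall>B\<in>P. \<forall>s\<in>B. \<forall>t\<in>B. x $ s = x $ t"
    by (auto simp: W_def)
next
  assume const: "\<forall>B\<in>P. \<forall>s\<in>B. \<forall>t\<in>B. x $ s = x $ t"
  \<comment> \<open>The common value of \<open>x\<close> on \<open>B\<close>; by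
    \<open>const\<close> the choice of representative does not matter.\<close>
  define c where "c B = x $ (SOME t. t \<in> B)" for B
  have c: "c B = x $ t" if "B \<in> P" "t \<in> B" for B t
    unfolding c_def using const that by (meson someI)
  have "x $ t = (\<Sum>B\<in>P. c B *\<^sub>R block_vec B) $ t" for t
  proof -
    \<comment> \<open>The blocks are disjoint, so only the summand of the block \<open>C\<close>
      around \<open>t\<close> survives at coordinate \<open>t\<close>.\<close>
    obtain C where C: "C \<in> P" "t \<in> C"
      using partition_onD1[OF assms] by blast
    have "(\<Sum>B\<in>P. c B *\<^sub>R block_vec B) $ t = (\<Sum>B\<in>P. if B = C then c B else 0)"
      unfolding sum_component
    proof (rule sum.cong)
      show "(c B *\<^sub>R block_vec B) $ t = (if B = C then c B else 0)" if "B \<in> P" for B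
        using C partition_on_block_unique[OF assms that C(1)] by (auto simp: block_vec_def)
    qed simp
    also have "\<dots> = x $ t"
      using C c by simp
    finally show ?thesis by simp
  qed
  then have "x = (\<Sum>B\<in>P. c B *\<^sub>R block_vec B)"
    by (simp add: vec_eq_iff)
  also have "\<dots> \<in> partition_space P"
    unfolding partition_space_def by (intro span_sum span_scale span_base imageI)
  finally show "x \<in> partition_space P" .
qed

lemma partition_space_subset_iff:
  fixes P S :: "'n::finite set set"
  assumes P: "partition_on UNIV P" and S: "partition_on UNIV S"
  shows "partition_space S \<subseteq> partition_space P \<longleftrightarrow> refines UNIV P S"
proof
  assume sub: "partition_space S \<subseteq> partition_space P"
  have "\<exists>C\<in>S. B \<subseteq> C" if B: "B \<in> P" for B
  proof -
    obtain t where t: "t \<in> B"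
      using partition_onD3[OF P] B by fastforce
    obtain C where C: "C \<in> S" "t \<in> C"
      using partition_onD1[OF S] by blast
    \<comment> \<open>The indicator of \<open>C\<close> is constant on \<open>B\<close> and equals 1
      at \<open>t\<close>, so it equals 1 on all of \<open>B\<close>.\<close>
    have "block_vec C \<in> partition_space P"
      using sub C(1) unfolding partition_space_def by (auto intro: span_base)
    then have "block_vec C $ s = block_vec C $ t" if "s \<in> B" for s
      using mem_partition_space_iff[OF P] B t that by blast
    then have "B \<subseteq> C"
      using C(2) by (fastforce simp: block_vec_def split: if_splits)
    then show ?thesis using C(1) by blast
  qed
  then show "refines UNIV P S"
    using P S by (simp add: refines_def)
next
  assume "refines UNIV P S"
  \<comment> \<open>Constancy on a block of \<open>S\<close> passes to the blocks of
    \<open>P\<close> inside it.\<close>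
  then show "partition_space S \<subseteq> partition_space P"
    unfolding refines_def mem_partition_space_iff[OF P] mem_partition_space_iff[OF S] subset_iff
    by meson
qed

lemma partition_space_eq_iff:
  fixes P S :: "'n::finite set set"
  assumes "partition_on UNIV P" "partition_on UNIV S"
  shows "partition_space P = partition_space S \<longleftrightarrow> P = S"
  using partition_space_subset_iff assms refines_asym by (metis order_refl)

lemma partition_on_level_sets: "partition_on UNIV (range (\<lambda>t. {s. f s = f t}))"
  by (auto simp: partition_on_def disjoint_def)

text \<open>Turns membership into a refinement statement, so that the least upper bound property can
  be applied to a single vector.\<close>

lemma mem_partition_space_iff_refines:
  fixes P :: "'n::finite set set"
  assumes P: "partition_on UNIV P"
  shows "x \<in> partition_space P \<longleftrightarrow> refines UNIV P (range (\<lambda>t. {s. x $ s = x $ t}))"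
proof -
  have "(\<forall>s\<in>B. \<forall>t\<in>B. x $ s = x $ t) \<longleftrightarrow> (\<exists>t. B \<subseteq> {s. x $ s = x $ t})" for B
  proof
    assume "\<forall>s\<in>B. \<forall>t\<in>B. x $ s = x $ t"
    \<comment> \<open>An empty \<open>B\<close> supplies no point \<open>t\<close>, but it lies in
      every level set.\<close>
    then show "\<exists>t. B \<subseteq> {s. x $ s = x $ t}" by (cases "B = {}") blast+
  qed (metis (mono_tags, lifting) mem_Collect_eq subsetD)
  then show ?thesis
    using P partition_on_level_sets[of "($) x"]
    by (simp add: mem_partition_space_iff refines_def)
qed

text \<open>One inclusion holds because \<open>J\<close> is an upper bound, the other because it is
  least, tested against the level sets of each \<open>x\<close>.\<close>

lemma partition_space_lub:
  fixes P Q J :: "'n::finite set set"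
  assumes J: "is_partition_lub UNIV P Q J"
  shows "partition_space J = partition_space P \<inter> partition_space Q"
proof -
  have ref: "refines UNIV P J" "refines UNIV Q J"
    and least: "\<And>S. refines UNIV P S \<Longrightarrow> refines UNIV Q S \<Longrightarrow> refines UNIV J S"
    using J by (auto simp: is_partition_lub_def)
  have part: "partition_on UNIV P" "partition_on UNIV Q" "partition_on UNIV J"
    using ref unfolding refines_def by blast+
  show ?thesis
  proof
    show "partition_space J \<subseteq> partition_space P \<inter> partition_space Q"
      using ref part by (simp add: partition_space_subset_iff)
    show "partition_space P \<inter> partition_space Q \<subseteq> partition_space J"
      using part least by (auto simp: mem_partition_space_iff_refines)
  qed
qed

theorem theorem4p1:
  fixes P Q R :: "'n::finite set set"
  assumes "partition_on (UNIV :: 'n set) P"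
    and "partition_on (UNIV :: 'n set) Q"
    and "partition_on (UNIV :: 'n set) R"
  shows "partition_join UNIV P Q = R \<longleftrightarrow>
         partition_space P \<inter> partition_space Q = partition_space R"
proof -
  have J: "is_partition_lub UNIV P Q (partition_join UNIV P Q)"
    using assms by (intro is_partition_lub_join)
  then have "partition_on UNIV (partition_join UNIV P Q)"
    by (simp add: is_partition_lub_def refines_def)
  then show ?thesis
    \<comment> \<open>With the intersection rewritten as the space of the join, the claim is
      injectivity of \<open>partition_space\<close>.\<close>
    using assms(3) by (simp add: partition_space_eq_iff flip: partition_space_lub[OF J])
qed

end
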